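(* Consider the stochastic direct-search algorithm described in the context, with $q>1$. Assume that $f$ is Lipschitz continuous with constant $L_f^*$ around any limit point of the sequence of iterates $\{X_k\}$. Let $K$ be the random set of indices of unsuccessful iterations. Suppose that for some $\varepsilon_q>0$ (independent of $k$), for every $k$ and every $\alpha>0$, almost surely $$\mathbb{P}\left(|F_k-F_k^g-(f(X_k)-f(X_k+\Delta_kG_k))|\ge \alpha\Delta_k^q \,\middle|\, \mathcal{F}_{k-1}\right)\le \frac{\varepsilon_q}{\alpha^{q/(q-1)}} ,$$ and that $\theta>\varepsilon_q^{1/r(q)}\,\bar\tau_q/\tau_q^-$ with $r(q)=\frac{q}{q-1}$. Then the following property holds almost surely: if $L\subset K$ is a random set such that the sequence $\{G_k\}_{k\in L}$ is dense in the unit sphere and $\lim_{k\in L,\,k\to\infty}X_k=X^*$, then the point $X^*$ is Clarke stationary, i.e. $f^\circ(X^*,d)\ge0$ for every $d\in\mathbb{R}^n$.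
   Context: $f:\mathbb{R}^n\to\mathbb{R}$ is locally Lipschitz continuous (possibly non-smooth) with $\inf f=f^*\in\mathbb{R}$. Stochastic direct-search algorithm. Parameters: deterministic $x_0\in\mathbb{R}^n$, $\delta_0>0$, and $\theta>0$, $q>1$, $\tau\in(0,1)$, $\bar\tau\in[1,1+\tau]$. Set $X_0=x_0$, $\Delta_0=\delta_0$. For $k=0,1,\dots$: select a (random) direction $G_k$ in the unit sphere of $\mathbb{R}^n$; compute random estimates $F_k$ and $F_k^g$ of $f(X_k)$ and $f(X_k+\Delta_kG_k)$; if $F_k-F_k^g\ge\theta\Delta_k^q$ (successful iteration), set $X_{k+1}=X_k+\Delta_kG_k$ and $\Delta_{k+1}=\bar\tau\Delta_k$; otherwise (unsuccessful iteration) set $X_{k+1}=X_k$ and $\Delta_{k+1}=(1-\tau)\Delta_k$. $\mathcal{F}_{k-1}$ is the $\sigma$-algebra generated by $(F_j,F_j^g)_{j=0}^{k-1}$ and $(G_j)_{j=0}^{k}$. Constants: $\tau_q^+=(1+\tau)^q-1$, $\tau_q^-=1-(1-\tau)^q$, $\bar\tau_q=\tau_q^++\tau_q^-$. Clarke generalized directional derivative: $f^\circ(x,d)=\limsup_{y\to x,\,t\downarrow0}\frac{f(y+td)-f(y)}{t}$. A sequence $\{v_k\}_{k\in L}$ of unit vectors is called dense in the unit sphere if for every unit vector $d$ there is an infinite set $S\subset L$ with $\lim_{k\in S,\,k\to\infty}v_k=d$ (for $n\ge2$ this is the same as ordinary density of $\{v_k:k\in L\}$ in the sphere). *)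

theory Defs
  imports "HOL-Probability.Probability"
begin

definition locally_lipschitz :: "('a::metric_space \<Rightarrow> 'b::metric_space) \<Rightarrow> bool" where
  "locally_lipschitz f \<longleftrightarrow> (\<forall>x. \<exists>U L. open U \<and> x \<in> U \<and> L-lipschitz_on U f)"

text \<open>The value is an extended real, so the limit superior always exists; it is finite
  when \<open>f\<close> is Lipschitz near \<open>x\<close>. The base point \<open>y\<close> may equal \<open>x\<close>.\<close>

definition clarke_deriv :: "('a::real_normed_vector \<Rightarrow> real) \<Rightarrow> 'a \<Rightarrow> 'a \<Rightarrow> ereal" where
  "clarke_deriv f x d =
     Limsup (nhds x \<times>\<^sub>F at_right (0::real)) (\<lambda>(y, t). ereal ((f (y + t *\<^sub>R d) - f y) / t))"

definition clarke_stationary :: "('a::real_normed_vector \<Rightarrow> real) \<Rightarrow> 'a \<Rightarrow> bool" where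
  "clarke_stationary f x \<longleftrightarrow> (\<forall>d. clarke_deriv f x d \<ge> 0)"

definition seq_limit_point :: "(nat \<Rightarrow> 'a::topological_space) \<Rightarrow> 'a \<Rightarrow> bool" where
  "seq_limit_point v x \<longleftrightarrow> (\<exists>s. strict_mono s \<and> (v \<circ> s) \<longlonglongrightarrow> x)"

text \<open>Convergence of \<open>v k\<close> to \<open>x\<close> as \<open>k \<rightarrow> \<infinity>\<close> along \<open>k \<in> S\<close>. It holds vacuously if \<open>S\<close> is finite.\<close>

definition tendsto_along :: "nat set \<Rightarrow> (nat \<Rightarrow> 'a::topological_space) \<Rightarrow> 'a \<Rightarrow> bool" where
  "tendsto_along S v x \<longleftrightarrow> (v \<longlongrightarrow> x) (inf sequentially (principal S))"

definition dense_in_sphere :: "nat set \<Rightarrow> (nat \<Rightarrow> 'a::real_normed_vector) \<Rightarrow> bool" where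
  "dense_in_sphere L v \<longleftrightarrow>
     (\<forall>d. norm d = 1 \<longrightarrow> (\<exists>S. S \<subseteq> L \<and> infinite S \<and> tendsto_along S v d))"

text \<open>\<open>Fg k\<close> stands for the estimate \<open>F\<^sub>k\<^sup>g\<close> at the trial point. No accuracy is imposed here on
  \<open>F k\<close> and \<open>Fg k\<close> as estimates of the objective, so the objective is not a parameter.\<close>

locale stochastic_direct_search = prob_space M
  for M :: "'w measure" +
  fixes x0 :: "'a::euclidean_space"
    and \<delta>0 \<theta> q \<tau> \<tau>bar :: real
    and G :: "nat \<Rightarrow> 'w \<Rightarrow> 'a"
    and F Fg :: "nat \<Rightarrow> 'w \<Rightarrow> real"
    and X :: "nat \<Rightarrow> 'w \<Rightarrow> 'a"
    and \<Delta> :: "nat \<Rightarrow> 'w \<Rightarrow> real"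
  assumes \<delta>0_pos: "\<delta>0 > 0"
    and \<theta>_pos: "\<theta> > 0"
    and q_gt_1: "q > 1"
    and \<tau>_range: "0 < \<tau>" "\<tau> < 1"
    and \<tau>bar_range: "1 \<le> \<tau>bar" "\<tau>bar \<le> 1 + \<tau>"
    and G_measurable: "\<And>k. G k \<in> borel_measurable M"
    and F_measurable: "\<And>k. F k \<in> borel_measurable M"
    and Fg_measurable: "\<And>k. Fg k \<in> borel_measurable M"
    and G_unit: "\<And>k w. w \<in> space M \<Longrightarrow> norm (G k w) = 1"
    and X_0: "\<And>w. w \<in> space M \<Longrightarrow> X 0 w = x0"
    and \<Delta>_0: "\<And>w. w \<in> space M \<Longrightarrow> \<Delta> 0 w = \<delta>0"
    and X_Suc: "\<And>k w. w \<in> space M \<Longrightarrow> X (Suc k) w =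
        (if F k w - Fg k w \<ge> \<theta> * \<Delta> k w powr q then X k w + \<Delta> k w *\<^sub>R G k w else X k w)"
    and \<Delta>_Suc: "\<And>k w. w \<in> space M \<Longrightarrow> \<Delta> (Suc k) w =
        (if F k w - Fg k w \<ge> \<theta> * \<Delta> k w powr q then \<tau>bar * \<Delta> k w else (1 - \<tau>) * \<Delta> k w)"

text \<open>Indices of unsuccessful iterations in the realization \<open>w\<close>.\<close>

definition unsuccessful ::
  "real \<Rightarrow> real \<Rightarrow> (nat \<Rightarrow> 'w \<Rightarrow> real) \<Rightarrow> (nat \<Rightarrow> 'w \<Rightarrow> real) \<Rightarrow> (nat \<Rightarrow> 'w \<Rightarrow> real) \<Rightarrow> 'w \<Rightarrow> nat set"
  where "unsuccessful \<theta> q F Fg \<Delta> w = {k. \<not> (F k w - Fg k w \<ge> \<theta> * \<Delta> k w powr q)}"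

text \<open>\<open>past M G F Fg k\<close> is the \<open>\<sigma>\<close>-algebra usually written with index \<open>k - 1\<close>: it contains the
  estimates of the iterations before \<open>k\<close> and the directions up to and including \<open>k\<close>.\<close>

definition past ::
  "'w measure \<Rightarrow> (nat \<Rightarrow> 'w \<Rightarrow> 'a::euclidean_space) \<Rightarrow> (nat \<Rightarrow> 'w \<Rightarrow> real) \<Rightarrow> (nat \<Rightarrow> 'w \<Rightarrow> real) \<Rightarrow>
   nat \<Rightarrow> 'w measure" where
  "past M G F Fg k = sigma (space M)
     ({F j -` A \<inter> space M | j A. j < k \<and> A \<in> sets borel} \<union>
      {Fg j -` A \<inter> space M | j A. j < k \<and> A \<in> sets borel} \<union>
      {G j -` A \<inter> space M | j A. j \<le> k \<and> A \<in> sets borel})"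

definition cond_prob_given :: "'w measure \<Rightarrow> 'w measure \<Rightarrow> 'w set \<Rightarrow> 'w \<Rightarrow> real" where
  "cond_prob_given M N A = real_cond_exp M N (indicator A)"

definition tau_plus :: "real \<Rightarrow> real \<Rightarrow> real" where
  "tau_plus q \<tau> = (1 + \<tau>) powr q - 1"

definition tau_minus :: "real \<Rightarrow> real \<Rightarrow> real" where
  "tau_minus q \<tau> = 1 - (1 - \<tau>) powr q"

definition tau_bar :: "real \<Rightarrow> real \<Rightarrow> real" where
  "tau_bar q \<tau> = tau_plus q \<tau> + tau_minus q \<tau>"

definition conj_exponent :: "real \<Rightarrow> real" where
  "conj_exponent q = q / (q - 1)"

end

theory Submission
  imports Defs
begin

text \<open>
  Write \<open>D\<close> for the true decrease \<open>f(X) - f(X + \<Delta>G)\<close> and \<open>E\<close> for the error of the estimated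
  decrease. Two facts drive the proof: almost surely the steps \<open>\<Delta>\<close> tend to zero, and the errors
  \<open>E\<close> are of smaller order than the steps.

  For the steps, the potential \<open>f(X) + \<eta> \<Delta>\<^sup>q\<close> with \<open>\<eta> = \<theta> / tau_bar\<close> decreases in expectation. An
  unsuccessful iteration lowers it by \<open>\<eta> tau_minus \<Delta>\<^sup>q\<close>. A successful one changes it by at most
  \<open>\<theta> \<Delta>\<^sup>q - D\<close> more than that, and passing the acceptance test forces the error to satisfy
  \<open>E \<ge> \<theta> \<Delta>\<^sup>q - D\<close>. The tail bound makes a false success of excess \<open>u \<Delta>\<^sup>q\<close> have conditional
  probability at most \<open>\<epsilon>\<^bsup>1/r\<^esup> / u\<close>, where \<open>r = q / (q - 1)\<close> is the conjugate exponent, so false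
  successes cost at most \<open>\<epsilon>\<^bsup>1/r\<^esup> \<Delta>\<^sup>q\<close> in expectation, whatever \<open>u\<close> is. The lower bound on \<open>\<theta>\<close>
  says exactly that this cost is less than \<open>\<eta> tau_minus \<Delta>\<^sup>q\<close>. Since \<open>f\<close> is bounded below, the
  expectations of \<open>\<Delta>\<^sup>q\<close> are summable (\<open>summable_expected_\<Delta>_powr\<close>).

  For the errors, the exponent \<open>r\<close> fits: the event \<open>\<bar>E\<bar> \<ge> a \<Delta>\<close> is \<open>\<bar>E\<bar> \<ge> (a \<Delta>\<^bsup>1-q\<^esup>) \<Delta>\<^sup>q\<close>, of
  conditional probability at most \<open>\<epsilon> a\<^bsup>-r\<^esup> \<Delta>\<^sup>q\<close> because \<open>(q - 1) r = q\<close>. These probabilities are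
  summable as well, and the Borel--Cantelli lemma yields \<open>E / \<Delta> \<longlonglongrightarrow> 0\<close>.

  On such a realization the rest is deterministic. An unsuccessful iteration has
  \<open>D < \<theta> \<Delta>\<^sup>q + \<bar>E\<bar>\<close>, so the difference quotient \<open>- D / \<Delta>\<close> is bounded below by a null sequence.
  Along indices where \<open>G\<close> converges to a given direction, the Lipschitz property near the limit
  point carries this over to the Clarke derivative (\<open>clarke_deriv_nonneg_along_filter\<close>). As the
  exceptional null set depends neither on the index set nor on the limit point, the conclusion
  holds for all of them simultaneously.
\<close>

section \<open>Clarke derivatives along a filter\<close>

lemma continuous_on_if_locally_lipschitz:
  assumes "locally_lipschitz f"
  shows "continuous_on UNIV f"
proof -
  have "isCont f x" for x
  proof -
    obtain U L where "open U" "x \<in> U" "L-lipschitz_on U f"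
      using assms unfolding locally_lipschitz_def by blast
    then show ?thesis
      using lipschitz_on_continuous_on continuous_on_eq_continuous_at by blast
  qed
  then show ?thesis
    by (simp add: continuous_at_imp_continuous_on)
qed

lemma sequentially_along_infinite_nontrivial:
  assumes "infinite S"
  shows "inf sequentially (principal S) \<noteq> bot"
proof
  assume "inf sequentially (principal S) = bot"
  then have "eventually (\<lambda>_. False) (inf sequentially (principal S))"
    by simp
  then have "\<forall>\<^sub>F k in sequentially. k \<notin> S"
    by (simp add: eventually_inf_principal)
  then show False
    using assms by (metis eventually_sequentially finite_nat_set_iff_bounded_le linorder_linear)
qed

lemma clarke_deriv_zero_direction: "clarke_deriv f x 0 = 0"
proof -
  have "nhds x \<times>\<^sub>F at_right (0::real) \<noteq> bot"
    by (simp add: prod_filter_eq_bot)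
  then have "Limsup (nhds x \<times>\<^sub>F at_right (0::real)) (\<lambda>_. 0::ereal) = 0"
    by (rule Limsup_const)
  moreover have "(\<lambda>(y, t::real). ereal ((f (y + t *\<^sub>R 0) - f y) / t)) = (\<lambda>_. 0)"
    by (auto simp: fun_eq_iff)
  ultimately show ?thesis
    unfolding clarke_deriv_def by simp
qed

text \<open>The limit superior only needs one family of base points and step sizes approaching
  \<open>(xs, 0+)\<close>. Replacing the direction \<open>g k\<close> by its limit \<open>d\<close> changes the quotient by at
  most \<open>C * norm (g k - d)\<close>, which the Lipschitz bound makes negligible.\<close>

lemma clarke_deriv_nonneg_along_filter:
  fixes x g :: "'i \<Rightarrow> 'a::real_normed_vector" and t e :: "'i \<Rightarrow> real"
  assumes nontriv: "A \<noteq> bot"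
    and U: "open U" "xs \<in> U" "C-lipschitz_on U f"
    and x: "(x \<longlongrightarrow> xs) A"
    and t: "(t \<longlongrightarrow> 0) A" "\<forall>\<^sub>F k in A. 0 < t k"
    and g: "(g \<longlongrightarrow> d) A"
    and e: "(e \<longlongrightarrow> 0) A"
    and quot: "\<forall>\<^sub>F k in A. - e k \<le> (f (x k + t k *\<^sub>R g k) - f (x k)) / t k"
  shows "0 \<le> clarke_deriv f xs d"
proof (rule ccontr)
  assume "\<not> 0 \<le> clarke_deriv f xs d"
  then have "clarke_deriv f xs d < ereal 0"
    by (simp add: zero_ereal_def)
  then obtain c where c: "clarke_deriv f xs d < ereal c" "c < 0"
    using ereal_dense2 by (metis ereal_less(2) less_ereal.simps(1))
  have "filterlim t (at_right 0) A"
    using t by (auto simp: filterlim_at elim: eventually_mono)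
  then have lim: "filterlim (\<lambda>k. (x k, t k)) (nhds xs \<times>\<^sub>F at_right 0) A"
    using x by (intro filterlim_Pair)
  have "\<forall>\<^sub>F (y, s) in nhds xs \<times>\<^sub>F at_right 0. (f (y + s *\<^sub>R d) - f y) / s < c"
    using Limsup_lessD[OF c(1)[unfolded clarke_deriv_def]] by (simp add: case_prod_unfold)
  then have small: "\<forall>\<^sub>F k in A. (f (x k + t k *\<^sub>R d) - f (x k)) / t k < c"
    using eventually_compose_filterlim[OF _ lim] by fastforce
  have "((\<lambda>k. x k + t k *\<^sub>R d) \<longlongrightarrow> xs + 0 *\<^sub>R d) A" "((\<lambda>k. x k + t k *\<^sub>R g k) \<longlongrightarrow> xs + 0 *\<^sub>R d) A"
    by (intro tendsto_intros x t g)+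
  then have inU: "\<forall>\<^sub>F k in A. x k + t k *\<^sub>R d \<in> U" "\<forall>\<^sub>F k in A. x k + t k *\<^sub>R g k \<in> U"
    using topological_tendstoD[OF _ U(1)] U(2) by auto
  have "((\<lambda>k. - e k - C * norm (g k - d)) \<longlongrightarrow> - 0 - C * norm (d - d)) A"
    by (intro tendsto_intros e g)
  then have "\<forall>\<^sub>F k in A. c < - e k - C * norm (g k - d)"
    using c(2) by (intro order_tendstoD(1)) auto
  then have "\<forall>\<^sub>F k in A. False"
    using small inU t(2) quot
  proof eventually_elim
    case (elim k)
    have "\<bar>f (x k + t k *\<^sub>R g k) - f (x k + t k *\<^sub>R d)\<bar> \<le> C * norm (t k *\<^sub>R (g k - d))"
      using lipschitz_onD[OF U(3) elim(4,3)] by (simp add: dist_norm algebra_simps)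
    also have "\<dots> = t k * (C * norm (g k - d))"
      using elim(5) by simp
    finally have "f (x k + t k *\<^sub>R g k) - f (x k + t k *\<^sub>R d) \<le> t k * (C * norm (g k - d))"
      by linarith
    then have "(f (x k + t k *\<^sub>R g k) - f (x k)) / t k - (f (x k + t k *\<^sub>R d) - f (x k)) / t k
        \<le> C * norm (g k - d)"
      using elim(5) by (simp add: field_simps)
    then show ?case
      using elim by linarith
  qed
  then show False
    using nontriv by simp
qed

section \<open>Two probabilistic tools\<close>

text \<open>Borel--Cantelli for each of the countably many levels \<open>1 / (m + 1)\<close>.\<close>

lemma (in prob_space) AE_tendsto_zero_if_summable_prob:
  fixes Y :: "nat \<Rightarrow> 'a \<Rightarrow> real"
  assumes meas[measurable]: "\<And>k. Y k \<in> borel_measurable M"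
    and sum: "\<And>a. 0 < a \<Longrightarrow> summable (\<lambda>k. prob {w \<in> space M. a \<le> \<bar>Y k w\<bar>})"
  shows "AE w in M. (\<lambda>k. Y k w) \<longlonglongrightarrow> 0"
proof -
  have "AE w in M. \<forall>\<^sub>F k in sequentially. w \<in> space M - {w \<in> space M. 1 / real (Suc m) \<le> \<bar>Y k w\<bar>}" for m
    by (rule borel_cantelli_AE1) (auto intro!: sum simp: emeasure_eq_measure)
  then have "AE w in M. \<forall>m. \<forall>\<^sub>F k in sequentially.
      w \<in> space M - {w \<in> space M. 1 / real (Suc m) \<le> \<bar>Y k w\<bar>}"
    by (simp only: AE_all_countable) simp
  then show ?thesis
  proof (rule AE_mp, intro AE_I2 impI)
    fix w
    assume ev: "\<forall>m. \<forall>\<^sub>F k in sequentially.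
      w \<in> space M - {w \<in> space M. 1 / real (Suc m) \<le> \<bar>Y k w\<bar>}"
    show "(\<lambda>k. Y k w) \<longlonglongrightarrow> 0"
    proof (rule tendstoI)
      fix r :: real assume "0 < r"
      then obtain m where m: "1 / real (Suc m) < r"
        using nat_approx_posE by blast
      show "\<forall>\<^sub>F k in sequentially. dist (Y k w) 0 < r"
        using ev[rule_format, of m] by eventually_elim (use m in auto)
    qed
  qed
qed

text \<open>A conditional tail bound that holds for each fixed threshold, off a null set depending on
  it, extends to thresholds \<open>U\<close> known to the conditioning algebra: the null sets of the rational
  thresholds have a null union, and below \<open>U\<close> the rational thresholds come arbitrarily close.\<close>

lemma (in finite_measure_subalgebra) cond_tail_bound_random_threshold:
  fixes h :: "real \<Rightarrow> real"
  assumes Z[measurable]: "Z \<in> borel_measurable M"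
    and U[measurable]: "U \<in> borel_measurable F"
    and h: "continuous_on {0<..} h"
    and tail: "\<And>\<alpha>. 0 < \<alpha> \<Longrightarrow>
      AE w in M. real_cond_exp M F (indicator {v \<in> space M. \<alpha> \<le> Z v}) w \<le> h \<alpha>"
  shows "AE w in M. 0 < U w \<longrightarrow>
    real_cond_exp M F (indicator {v \<in> space M. U v \<le> Z v}) w \<le> h (U w)"
proof -
  have space_F: "space F = space M"
    using subalg by (simp add: subalgebra_def)
  have U_M[measurable]: "U \<in> borel_measurable M"
    by (rule measurable_from_subalg[OF subalg U])
  let ?E = "{v \<in> space M. U v \<le> Z v}"
  let ?p = "real_cond_exp M F (indicator ?E)"
  have rational: "AE w in M. \<beta> < U w \<longrightarrow> ?p w \<le> h \<beta>" if "0 < \<beta>" for \<beta> :: real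
  proof -
    define A where "A = {w \<in> space F. \<beta> < U w}"
    have A[measurable]: "A \<in> sets F"
      unfolding A_def by measurable
    then have A_M[measurable]: "A \<in> sets M"
      using subalg by (auto simp: subalgebra_def)
    let ?g = "\<lambda>w. indicator A w * indicator ?E w :: real"
    have int_g: "integrable M ?g"
      by (rule integrable_const_bound[where B=1]) (auto simp: indicator_def)
    have int_tail: "integrable M (indicator {v \<in> space M. \<beta> \<le> Z v} :: 'a \<Rightarrow> real)"
      by (rule integrable_const_bound[where B=1]) (auto simp: indicator_def)
    have "AE w in M. real_cond_exp M F ?g w = indicator A w * ?p w"
      by (rule real_cond_exp_mult) (use int_g in auto)
    moreover have "AE w in M. real_cond_exp M F ?g w
        \<le> real_cond_exp M F (indicator {v \<in> space M. \<beta> \<le> Z v}) w"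
      by (rule real_cond_exp_mono) (use int_g int_tail in \<open>auto simp: A_def indicator_def\<close>)
    ultimately show ?thesis
      using tail[OF that] AE_space by eventually_elim (auto simp: A_def space_F)
  qed
  have "AE w in M. \<forall>\<beta>\<in>{\<beta>\<in>\<rat>. 0 < \<beta>}. \<beta> < U w \<longrightarrow> ?p w \<le> h \<beta>"
  proof (rule AE_ball_countable')
    show "countable {\<beta>::real. \<beta> \<in> \<rat> \<and> 0 < \<beta>}"
      by (rule countable_subset[OF _ countable_rat]) auto
  qed (use rational in auto)
  then show ?thesis
  proof (rule AE_mp, intro AE_I2 impI)
    fix w
    assume bound: "\<forall>\<beta>\<in>{\<beta>\<in>\<rat>. 0 < \<beta>}. \<beta> < U w \<longrightarrow> ?p w \<le> h \<beta>" and pos: "0 < U w"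
    show "?p w \<le> h (U w)"
    proof (rule ccontr)
      assume "\<not> ?p w \<le> h (U w)"
      moreover have "isCont h (U w)"
        using h pos by (simp add: continuous_on_eq_continuous_at)
      ultimately have "\<forall>\<^sub>F \<beta> in at_left (U w). h \<beta> < ?p w"
        by (intro order_tendstoD(2)[of h "h (U w)"])
           (auto simp: isCont_def intro: tendsto_within_subset)
      then obtain b where b: "b < U w" "\<And>\<beta>. b < \<beta> \<Longrightarrow> \<beta> < U w \<Longrightarrow> h \<beta> < ?p w"
        unfolding eventually_at_left_field by blast
      obtain \<beta> where "\<beta> \<in> \<rat>" "max b 0 < \<beta>" "\<beta> < U w"
        using Rats_dense_in_real[of "max b 0" "U w"] b(1) pos by auto
      then show False
        using b(2)[of \<beta>] bound by fastforce
    qed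
  qed
qed

text \<open>The form in which tail bounds with random thresholds are used: \<open>W\<close> is the loss incurred on
  the event \<open>U \<le> Z\<close>, and \<open>Y\<close> dominates its conditional expectation.\<close>

lemma (in finite_measure_subalgebra) integral_weighted_tail_le:
  fixes h :: "real \<Rightarrow> real"
  assumes Z[measurable]: "Z \<in> borel_measurable M"
    and U[measurable]: "U \<in> borel_measurable F"
    and W[measurable]: "W \<in> borel_measurable F"
    and h: "continuous_on {0<..} h"
    and tail: "\<And>\<alpha>. 0 < \<alpha> \<Longrightarrow>
      AE w in M. real_cond_exp M F (indicator {v \<in> space M. \<alpha> \<le> Z v}) w \<le> h \<alpha>"
    and int_W: "integrable M W"
    and int_Y: "integrable M Y"
    and W_pos: "\<And>w. w \<in> space M \<Longrightarrow> 0 \<le> W w"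
    and U_pos: "\<And>w. w \<in> space M \<Longrightarrow> 0 < W w \<Longrightarrow> 0 < U w"
    and le_Y: "\<And>w. w \<in> space M \<Longrightarrow> W w * h (U w) \<le> Y w"
  shows "(\<integral>w. W w * indicator {v \<in> space M. U v \<le> Z v} w \<partial>M) \<le> (\<integral>w. Y w \<partial>M)"
proof -
  have [measurable]: "U \<in> borel_measurable M"
    by (rule measurable_from_subalg[OF subalg U])
  let ?E = "{v \<in> space M. U v \<le> Z v}"
  have int: "integrable M (\<lambda>w. W w * indicator ?E w)"
    by (rule integrable_real_mult_indicator[OF _ int_W]) measurable
  have threshold: "AE w in M. 0 < U w \<longrightarrow> real_cond_exp M F (indicator ?E) w \<le> h (U w)"
    by (rule cond_tail_bound_random_threshold[OF Z U h tail])
  note intg = real_cond_exp_intg[OF int W]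
  have "(\<integral>w. W w * indicator ?E w \<partial>M) = (\<integral>w. W w * real_cond_exp M F (indicator ?E) w \<partial>M)"
    by (rule intg(2)[symmetric]) measurable
  also have "\<dots> \<le> (\<integral>w. Y w \<partial>M)"
  proof (rule integral_mono_AE)
    show "integrable M (\<lambda>w. W w * real_cond_exp M F (indicator ?E) w)"
      by (rule intg(1)) measurable
    show "AE w in M. W w * real_cond_exp M F (indicator ?E) w \<le> Y w"
      using threshold AE_space
    proof eventually_elim
      case (elim w)
      have "W w * real_cond_exp M F (indicator ?E) w \<le> W w * h (U w)"
        using elim W_pos[of w] U_pos[of w] by (cases "W w = 0") (auto intro: mult_left_mono)
      then show ?case
        using le_Y elim(2) by fastforce
    qed
  qed (rule int_Y)
  finally show "(\<integral>w. W w * indicator ?E w \<partial>M) \<le> (\<integral>w. Y w \<partial>M)" .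
qed

lemma (in prob_space) cond_exp_indicator_le_1:
  assumes "subalgebra M N" "A \<in> sets M"
  shows "AE w in M. real_cond_exp M N (indicator A) w \<le> 1"
proof -
  interpret finite_measure_subalgebra M N
    by unfold_locales (rule assms(1))
  show ?thesis
    using assms(2) by (intro real_cond_exp_le_c AE_I2)
      (auto simp: indicator_def emeasure_eq_measure)
qed

section \<open>Runs of the algorithm\<close>

context stochastic_direct_search
begin

lemma \<Delta>_pos: "w \<in> space M \<Longrightarrow> 0 < \<Delta> k w"
  by (induction k) (use \<delta>0_pos \<tau>_range \<tau>bar_range in \<open>auto simp: \<Delta>_0 \<Delta>_Suc\<close>)

lemma \<Delta>_le:
  assumes "w \<in> space M"
  shows "\<Delta> k w \<le> \<delta>0 * (1 + \<tau>) ^ k"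
proof (induction k)
  case (Suc k)
  have "\<Delta> (Suc k) w \<le> (1 + \<tau>) * \<Delta> k w"
    using \<Delta>_pos[OF assms, of k] \<tau>_range \<tau>bar_range
    by (auto simp: \<Delta>_Suc[OF assms] intro!: mult_right_mono)
  also have "\<dots> \<le> (1 + \<tau>) * (\<delta>0 * (1 + \<tau>) ^ k)"
    using Suc \<tau>_range by (intro mult_left_mono) auto
  finally show ?case
    by (simp add: mult_ac)
qed (use assms in \<open>simp add: \<Delta>_0\<close>)

text \<open>At each fixed iteration the iterate and the trial point range over a bounded set, because the
  starting point and the initial step are deterministic. This settles all integrability questions
  for continuous objectives.\<close>

lemma norm_trial_point_le:
  assumes "w \<in> space M"
  shows "norm (X k w + \<Delta> k w *\<^sub>R G k w) \<le> norm (X k w) + \<delta>0 * (1 + \<tau>) ^ k"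
  using norm_triangle_ineq[of "X k w" "\<Delta> k w *\<^sub>R G k w"] \<Delta>_le[OF assms, of k]
    \<Delta>_pos[OF assms, of k] G_unit[OF assms, of k] by simp

lemma X_bounded: "\<exists>B. \<forall>w\<in>space M. norm (X k w) \<le> B"
proof (induction k)
  case 0
  then show ?case
    by (auto simp: X_0)
next
  case (Suc k)
  then obtain B where B: "\<And>w. w \<in> space M \<Longrightarrow> norm (X k w) \<le> B"
    by blast
  have "norm (X (Suc k) w) \<le> B + \<delta>0 * (1 + \<tau>) ^ k" if w: "w \<in> space M" for w
    using norm_trial_point_le[OF w, of k] B[OF w] \<Delta>_le[OF w, of k] \<Delta>_pos[OF w, of k]
    by (simp add: X_Suc[OF w])
  then show ?case
    by blast
qed

lemma space_past [simp]: "space (past M G F Fg k) = space M"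
  by (simp add: past_def space_measure_of_conv)

lemma past_measurable:
  "j < k \<Longrightarrow> F j \<in> borel_measurable (past M G F Fg k)"
  "j < k \<Longrightarrow> Fg j \<in> borel_measurable (past M G F Fg k)"
  "j \<le> k \<Longrightarrow> G j \<in> borel_measurable (past M G F Fg k)"
proof -
  let ?gen = "{F j -` A \<inter> space M | j A. j < k \<and> A \<in> sets borel} \<union>
      {Fg j -` A \<inter> space M | j A. j < k \<and> A \<in> sets borel} \<union>
      {G j -` A \<inter> space M | j A. j \<le> k \<and> A \<in> sets borel}"
  have generator: "A \<in> ?gen \<Longrightarrow> A \<in> sets (past M G F Fg k)" for A
    unfolding past_def by (rule in_measure_of) auto
  show "F j \<in> borel_measurable (past M G F Fg k)" if "j < k"
  proof (rule measurableI)
    fix A :: "real set" assume "A \<in> sets borel"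
    then have "F j -` A \<inter> space M \<in> ?gen"
      by (intro UnI1 CollectI exI[of _ j] exI[of _ A]) (simp add: that)
    then show "F j -` A \<inter> space (past M G F Fg k) \<in> sets (past M G F Fg k)"
      unfolding space_past by (rule generator)
  qed simp
  show "Fg j \<in> borel_measurable (past M G F Fg k)" if "j < k"
  proof (rule measurableI)
    fix A :: "real set" assume "A \<in> sets borel"
    then have "Fg j -` A \<inter> space M \<in> ?gen"
      by (intro UnI1[OF UnI2] CollectI exI[of _ j] exI[of _ A]) (simp add: that)
    then show "Fg j -` A \<inter> space (past M G F Fg k) \<in> sets (past M G F Fg k)"
      unfolding space_past by (rule generator)
  qed simp
  show "G j \<in> borel_measurable (past M G F Fg k)" if "j \<le> k"
  proof (rule measurableI)
    fix A :: "'a set" assume "A \<in> sets borel"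
    then have "G j -` A \<inter> space M \<in> ?gen"
      by (intro UnI2 CollectI exI[of _ j] exI[of _ A]) (simp add: that)
    then show "G j -` A \<inter> space (past M G F Fg k) \<in> sets (past M G F Fg k)"
      unfolding space_past by (rule generator)
  qed simp
qed

lemma subalgebra_past: "subalgebra M (past M G F Fg k)"
  unfolding subalgebra_def
proof (intro conjI)
  show "sets (past M G F Fg k) \<subseteq> sets M"
    unfolding past_def
    by (subst sets_measure_of; (intro sets.sigma_sets_subset)?)
       (auto intro: measurable_sets[OF F_measurable] measurable_sets[OF Fg_measurable]
          measurable_sets[OF G_measurable])
qed simp

lemma iterate_past_measurable:
  "j \<le> k \<Longrightarrow> X j \<in> borel_measurable (past M G F Fg k) \<and> \<Delta> j \<in> borel_measurable (past M G F Fg k)"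
proof (induction j)
  case 0
  have "X 0 \<in> borel_measurable (past M G F Fg k) \<longleftrightarrow> (\<lambda>_. x0) \<in> borel_measurable (past M G F Fg k)"
    "\<Delta> 0 \<in> borel_measurable (past M G F Fg k) \<longleftrightarrow> (\<lambda>_. \<delta>0) \<in> borel_measurable (past M G F Fg k)"
    by (rule measurable_cong; simp add: X_0 \<Delta>_0)+
  then show ?case
    by simp
next
  case (Suc j)
  then have [measurable]: "X j \<in> borel_measurable (past M G F Fg k)"
    "\<Delta> j \<in> borel_measurable (past M G F Fg k)" "F j \<in> borel_measurable (past M G F Fg k)"
    "Fg j \<in> borel_measurable (past M G F Fg k)" "G j \<in> borel_measurable (past M G F Fg k)"
    by (auto intro: past_measurable)
  let ?succ = "\<lambda>w. \<theta> * \<Delta> j w powr q \<le> F j w - Fg j w"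
  have "X (Suc j) \<in> borel_measurable (past M G F Fg k) \<longleftrightarrow>
      (\<lambda>w. if ?succ w then X j w + \<Delta> j w *\<^sub>R G j w else X j w) \<in> borel_measurable (past M G F Fg k)"
    "\<Delta> (Suc j) \<in> borel_measurable (past M G F Fg k) \<longleftrightarrow>
      (\<lambda>w. if ?succ w then \<tau>bar * \<Delta> j w else (1 - \<tau>) * \<Delta> j w) \<in> borel_measurable (past M G F Fg k)"
    by (rule measurable_cong; simp add: X_Suc \<Delta>_Suc)+
  then show ?case
    by simp
qed

lemma iterate_measurable [measurable]:
  "X k \<in> borel_measurable M" "\<Delta> k \<in> borel_measurable M"
  by (rule measurable_from_subalg[OF subalgebra_past[of k]]; simp add: iterate_past_measurable)+

lemmas [measurable] = F_measurable Fg_measurable G_measurable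

lemma \<Delta>_powr_integrable: "integrable M (\<lambda>w. \<Delta> k w powr q)"
proof (rule integrable_const_bound)
  show "AE w in M. norm (\<Delta> k w powr q) \<le> (\<delta>0 * (1 + \<tau>) ^ k) powr q"
    using \<Delta>_le \<Delta>_pos q_gt_1 by (intro AE_I2) (auto intro!: powr_mono2 simp: less_imp_le)
qed measurable

end

section \<open>Summability of the step sizes\<close>

locale direct_search_with_objective =
  stochastic_direct_search M x0 \<delta>0 \<theta> q \<tau> \<tau>bar G F Fg X \<Delta>
  for M :: "'w measure" and x0 :: "'a::euclidean_space" and \<delta>0 \<theta> q \<tau> \<tau>bar G F Fg X \<Delta> +
  fixes f :: "'a \<Rightarrow> real" and fstar \<epsilon> :: real
  assumes f_continuous: "continuous_on UNIV f"
    and f_lower: "\<And>x. fstar \<le> f x"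
    and \<epsilon>_pos: "0 < \<epsilon>"
    and tail_bound: "\<And>k \<alpha>. 0 < \<alpha> \<Longrightarrow> AE w in M.
          cond_prob_given M (past M G F Fg k)
            {v \<in> space M. \<bar>F k v - Fg k v - (f (X k v) - f (X k v + \<Delta> k v *\<^sub>R G k v))\<bar>
                            \<ge> \<alpha> * \<Delta> k v powr q} w
          \<le> \<epsilon> / \<alpha> powr conj_exponent q"
    and \<theta>_large: "\<epsilon> powr (1 / conj_exponent q) * tau_bar q \<tau> / tau_minus q \<tau> < \<theta>"
begin

definition decrease :: "nat \<Rightarrow> 'w \<Rightarrow> real" where
  "decrease k w = f (X k w) - f (X k w + \<Delta> k w *\<^sub>R G k w)"

definition err :: "nat \<Rightarrow> 'w \<Rightarrow> real" where
  "err k w = F k w - Fg k w - decrease k w"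

text \<open>The error in the unit in which the tail bound measures it.\<close>

definition scaled_err :: "nat \<Rightarrow> 'w \<Rightarrow> real" where
  "scaled_err k w = \<bar>err k w\<bar> / \<Delta> k w powr q"

lemma f_measurable [measurable]: "f \<in> borel_measurable borel"
  using f_continuous by (rule borel_measurable_continuous_onI)

lemma decrease_past_measurable: "decrease k \<in> borel_measurable (past M G F Fg k)"
proof -
  have [measurable]: "X k \<in> borel_measurable (past M G F Fg k)"
    "\<Delta> k \<in> borel_measurable (past M G F Fg k)" "G k \<in> borel_measurable (past M G F Fg k)"
    by (simp_all add: iterate_past_measurable past_measurable)
  show ?thesis
    unfolding decrease_def by measurable
qed

lemma error_measurable [measurable]:
  "decrease k \<in> borel_measurable M" "err k \<in> borel_measurable M" "scaled_err k \<in> borel_measurable M"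
  unfolding decrease_def err_def scaled_err_def by measurable

lemma f_bounded_integrable:
  assumes [measurable]: "V \<in> borel_measurable M" and B: "\<And>w. w \<in> space M \<Longrightarrow> norm (V w) \<le> B"
  shows "integrable M (\<lambda>w. f (V w))"
proof -
  have "compact (f ` cball 0 B)"
    by (intro compact_continuous_image continuous_on_subset[OF f_continuous]) auto
  then obtain C where "\<forall>y\<in>f ` cball 0 B. norm y \<le> C"
    using compact_imp_bounded bounded_iff by metis
  then show ?thesis
    by (intro integrable_const_bound[where B=C] AE_I2) (use B in auto)
qed

lemma f_X_integrable: "integrable M (\<lambda>w. f (X k w))"
  using X_bounded[of k] f_bounded_integrable[of "X k"] by auto

lemma decrease_integrable: "integrable M (decrease k)"
proof -
  obtain B where B: "\<And>w. w \<in> space M \<Longrightarrow> norm (X k w) \<le> B"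
    using X_bounded by blast
  have "integrable M (\<lambda>w. f (X k w + \<Delta> k w *\<^sub>R G k w))"
  proof (rule f_bounded_integrable)
    show "norm (X k w + \<Delta> k w *\<^sub>R G k w) \<le> B + \<delta>0 * (1 + \<tau>) ^ k" if "w \<in> space M" for w
      using norm_trial_point_le[OF that, of k] B[OF that] by linarith
  qed measurable
  then show ?thesis
    unfolding decrease_def using f_X_integrable by simp
qed

lemma scaled_err_tail:
  assumes "0 < \<alpha>"
  shows "AE w in M. real_cond_exp M (past M G F Fg k)
      (indicator {v \<in> space M. \<alpha> \<le> scaled_err k v}) w \<le> \<epsilon> / \<alpha> powr conj_exponent q"
proof -
  have "{v \<in> space M. \<alpha> \<le> scaled_err k v} = {v \<in> space M.
      \<bar>F k v - Fg k v - (f (X k v) - f (X k v + \<Delta> k v *\<^sub>R G k v))\<bar> \<ge> \<alpha> * \<Delta> k v powr q}"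
    using \<Delta>_pos by (auto simp: scaled_err_def err_def decrease_def field_simps less_le)
  then show ?thesis
    using tail_bound[OF assms, of k] by (simp add: cond_prob_given_def)
qed

lemma conj_exponent_gt_1: "1 < conj_exponent q"
  using q_gt_1 by (simp add: conj_exponent_def)

text \<open>A probability \<open>p\<close> with \<open>p \<le> \<epsilon> / \<alpha>\<^sup>r\<close> satisfies \<open>p \<le> p\<^bsup>1/r\<^esup> \<le> \<epsilon>\<^bsup>1/r\<^esup> / \<alpha>\<close>. This weaker bound
  decays like \<open>1 / \<alpha>\<close>, so its product with a loss proportional to \<open>\<alpha>\<close> is constant.\<close>

lemma scaled_err_weak_tail:
  assumes \<alpha>: "0 < \<alpha>"
  shows "AE w in M. real_cond_exp M (past M G F Fg k)
      (indicator {v \<in> space M. \<alpha> \<le> scaled_err k v}) w \<le> \<epsilon> powr (1 / conj_exponent q) / \<alpha>"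
proof -
  define r where "r = conj_exponent q"
  define s where "s = \<epsilon> powr (1 / r) / \<alpha>"
  have r: "1 < r"
    using conj_exponent_gt_1 by (simp add: r_def)
  have s: "0 < s"
    using \<epsilon>_pos \<alpha> by (simp add: s_def)
  have "\<epsilon> / \<alpha> powr r = s powr r"
    using r \<epsilon>_pos \<alpha> by (simp add: s_def powr_divide powr_powr)
  moreover have "s powr r \<le> s" if "s \<le> 1"
    using powr_mono'[of 1 r s] that r s by simp
  ultimately have "p \<le> s" if "p \<le> 1" "p \<le> \<epsilon> / \<alpha> powr r" for p
    using that by force
  moreover have "{v \<in> space M. \<alpha> \<le> scaled_err k v} \<in> sets M"
    by measurable
  note cond_exp_indicator_le_1[OF subalgebra_past this, of k]
  ultimately show ?thesis
    using scaled_err_tail[OF \<alpha>, of k] unfolding r_def s_def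
    by (auto elim: eventually_elim2)
qed

text \<open>The weight \<open>\<theta> / tau_bar\<close> is the one for which, after a success, the gain from growing the step
  instead of shrinking it is at most \<open>\<theta> \<Delta>\<^sup>q\<close>, the decrease that a success is meant to certify.\<close>

definition potential :: "nat \<Rightarrow> 'w \<Rightarrow> real" where
  "potential k w = f (X k w) + \<theta> / tau_bar q \<tau> * \<Delta> k w powr q"

text \<open>The decay of the potential at an unsuccessful iteration, less the bound on the expected cost
  of false successes, both per unit of \<open>\<Delta>\<^sup>q\<close>.\<close>

definition rate :: real where
  "rate = \<theta> / tau_bar q \<tau> * tau_minus q \<tau> - \<epsilon> powr (1 / conj_exponent q)"

lemma tau_pos: "0 < tau_plus q \<tau>" "0 < tau_minus q \<tau>" "0 < tau_bar q \<tau>"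
proof -
  show "0 < tau_plus q \<tau>"
    using \<tau>_range q_gt_1 gr_one_powr[of "1 + \<tau>" q] by (simp add: tau_plus_def)
  moreover show "0 < tau_minus q \<tau>"
    using \<tau>_range q_gt_1 powr_less_mono2[of q "1 - \<tau>" 1] by (simp add: tau_minus_def)
  ultimately show "0 < tau_bar q \<tau>"
    by (simp add: tau_bar_def)
qed

lemma rate_pos: "0 < rate"
  using \<theta>_large tau_pos by (simp add: rate_def field_simps)

text \<open>The first correction is the change at an unsuccessful iteration. The second is the excess at a
  success: there the acceptance test \<open>F - Fg \<ge> \<theta> \<Delta>\<^sup>q\<close> forces the error to be at least
  \<open>\<theta> \<Delta>\<^sup>q - decrease\<close>, which is the event in the indicator. The threshold depends only on the past,
  so the conditional tail bound applies to it.\<close>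

lemma potential_step_le:
  assumes w: "w \<in> space M"
  shows "potential (Suc k) w \<le> potential k w
    - \<theta> / tau_bar q \<tau> * tau_minus q \<tau> * \<Delta> k w powr q
    + max 0 (\<theta> * \<Delta> k w powr q - decrease k w)
      * indicator {v \<in> space M. \<theta> - decrease k v / \<Delta> k v powr q \<le> scaled_err k v} w"
    (is "_ \<le> _ - _ + max 0 ?gap * indicator ?E w")
proof -
  define \<eta> where "\<eta> = \<theta> / tau_bar q \<tau>"
  have \<eta>: "0 < \<eta>" "\<eta> * (tau_plus q \<tau> + tau_minus q \<tau>) = \<theta>"
    using \<theta>_pos tau_pos by (simp_all add: \<eta>_def tau_bar_def)
  have \<Delta>: "0 < \<Delta> k w"
    by (rule \<Delta>_pos[OF w])
  show ?thesis
  proof (cases "F k w - Fg k w \<ge> \<theta> * \<Delta> k w powr q")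
    case True
    have "?gap \<le> \<bar>err k w\<bar>"
      using True by (simp add: err_def)
    then have "w \<in> ?E"
      using w \<Delta> by (simp add: scaled_err_def field_simps)
    have "\<tau>bar powr q \<le> (1 + \<tau>) powr q"
      using \<tau>bar_range q_gt_1 by (intro powr_mono2) auto
    then have "(\<tau>bar * \<Delta> k w) powr q \<le> (1 + tau_plus q \<tau>) * \<Delta> k w powr q"
      using \<tau>bar_range \<Delta> by (simp add: powr_mult tau_plus_def mult_right_mono)
    then have "\<eta> * (\<tau>bar * \<Delta> k w) powr q \<le> \<eta> * ((1 + tau_plus q \<tau>) * \<Delta> k w powr q)"
      using \<eta>(1) by (intro mult_left_mono) auto
    also have "\<dots> = \<eta> * \<Delta> k w powr q + (\<eta> * (tau_plus q \<tau> + tau_minus q \<tau>)) * \<Delta> k w powr q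
        - \<eta> * tau_minus q \<tau> * \<Delta> k w powr q"
      by (simp add: algebra_simps)
    finally have "\<eta> * (\<tau>bar * \<Delta> k w) powr q
        \<le> \<eta> * \<Delta> k w powr q + \<theta> * \<Delta> k w powr q - \<eta> * tau_minus q \<tau> * \<Delta> k w powr q"
      by (simp add: \<eta>(2))
    then show ?thesis
      using True \<open>w \<in> ?E\<close>
      by (simp add: potential_def X_Suc[OF w] \<Delta>_Suc[OF w] decrease_def \<eta>_def[symmetric])
  next
    case False
    have "((1 - \<tau>) * \<Delta> k w) powr q = (1 - \<tau>) powr q * \<Delta> k w powr q"
      by (rule powr_mult)
    then have "\<eta> * ((1 - \<tau>) * \<Delta> k w) powr q = \<eta> * \<Delta> k w powr q - \<eta> * tau_minus q \<tau> * \<Delta> k w powr q"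
      unfolding tau_minus_def by algebra
    moreover have "0 \<le> max 0 ?gap * indicator ?E w"
      by simp
    ultimately show ?thesis
      using False by (simp add: potential_def X_Suc[OF w] \<Delta>_Suc[OF w] \<eta>_def[symmetric])
  qed
qed

lemma potential_integrable: "integrable M (potential k)"
  unfolding potential_def using f_X_integrable \<Delta>_powr_integrable by simp

text \<open>The weight \<open>W\<close> equals \<open>U \<Delta>\<^sup>q\<close> where the threshold \<open>U\<close> is positive and vanishes elsewhere, so
  the weak tail bound \<open>c / U\<close> cancels \<open>U\<close> and leaves \<open>c \<Delta>\<^sup>q\<close>.\<close>

lemma expected_potential_decrease:
  "expectation (potential (Suc k)) + rate * expectation (\<lambda>w. \<Delta> k w powr q)
    \<le> expectation (potential k)"
proof -
  let ?N = "past M G F Fg k"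
  interpret N: finite_measure_subalgebra M ?N
    by unfold_locales (rule subalgebra_past)
  define c where "c = \<epsilon> powr (1 / conj_exponent q)"
  define U where "U = (\<lambda>w. \<theta> - decrease k w / \<Delta> k w powr q)"
  define W where "W = (\<lambda>w. max 0 (\<theta> * \<Delta> k w powr q - decrease k w))"
  let ?E = "{v \<in> space M. U v \<le> scaled_err k v}"
  have [measurable]: "decrease k \<in> borel_measurable ?N" "\<Delta> k \<in> borel_measurable ?N"
    by (simp_all add: decrease_past_measurable iterate_past_measurable)
  have WU: "W w = max 0 (U w) * \<Delta> k w powr q" if "w \<in> space M" for w
    using \<Delta>_pos[OF that, of k] by (simp add: W_def U_def max_def field_simps)
  have int_W: "integrable M W"
    unfolding W_def using decrease_integrable \<Delta>_powr_integrable by simp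
  then have int: "integrable M (\<lambda>w. W w * indicator ?E w)"
    by (rule integrable_real_mult_indicator[rotated]) (simp add: U_def)
  have "(\<integral>w. W w * indicator ?E w \<partial>M) \<le> (\<integral>w. c * \<Delta> k w powr q \<partial>M)"
  proof (rule N.integral_weighted_tail_le[where h = "\<lambda>\<alpha>. c / \<alpha>"])
    show "continuous_on {0<..} (\<lambda>\<alpha>. c / \<alpha>)"
      by (intro continuous_intros) auto
    show "W w * (c / U w) \<le> c * \<Delta> k w powr q" if "w \<in> space M" for w
      using WU[OF that] by (auto simp: max_def c_def)
    show "0 < U w" if "w \<in> space M" "0 < W w" for w
      using WU[OF that(1)] that(2) by (cases "U w \<le> 0") auto
    show "AE w in M. real_cond_exp M ?N (indicator {v \<in> space M. \<alpha> \<le> scaled_err k v}) w \<le> c / \<alpha>"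
      if "0 < \<alpha>" for \<alpha>
      unfolding c_def using that by (rule scaled_err_weak_tail)
  qed (use int_W \<Delta>_powr_integrable in \<open>auto simp: W_def U_def\<close>)
  then have le: "expectation (\<lambda>w. W w * indicator ?E w) \<le> c * expectation (\<lambda>w. \<Delta> k w powr q)"
    by simp
  let ?b = "\<theta> / tau_bar q \<tau> * tau_minus q \<tau>"
  have "expectation (potential (Suc k))
      \<le> expectation (\<lambda>w. potential k w - ?b * \<Delta> k w powr q + W w * indicator ?E w)"
    using potential_step_le potential_integrable \<Delta>_powr_integrable int
    by (intro integral_mono) (auto simp: W_def U_def)
  also have "\<dots> = expectation (potential k) - ?b * expectation (\<lambda>w. \<Delta> k w powr q)
      + expectation (\<lambda>w. W w * indicator ?E w)"
    using potential_integrable \<Delta>_powr_integrable int by simp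
  finally show ?thesis
    using le by (simp add: rate_def c_def[symmetric] algebra_simps)
qed

lemma summable_expected_\<Delta>_powr: "summable (\<lambda>k. expectation (\<lambda>w. \<Delta> k w powr q))"
proof (rule bounded_imp_summable)
  show "0 \<le> expectation (\<lambda>w. \<Delta> k w powr q)" for k
    by (intro integral_nonneg_AE AE_I2) simp
  fix n
  have telescope: "rate * (\<Sum>k<n. expectation (\<lambda>w. \<Delta> k w powr q))
      \<le> expectation (potential 0) - expectation (potential n)" for n
  proof (induction n)
    case (Suc n)
    then show ?case
      using expected_potential_decrease[of n] by (simp add: algebra_simps)
  qed simp
  have "fstar \<le> potential k w" for k w
    using f_lower[of "X k w"] \<theta>_pos tau_pos by (simp add: potential_def add_increasing2)
  then have "fstar \<le> expectation (potential k)" for k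
    using integral_mono[of M "\<lambda>_. fstar" "potential k"] potential_integrable
    by (simp add: prob_space)
  then have "rate * (\<Sum>k<Suc n. expectation (\<lambda>w. \<Delta> k w powr q)) \<le> expectation (potential 0) - fstar"
    using telescope[of "Suc n"] by (smt (verit))
  then show "(\<Sum>k\<le>n. expectation (\<lambda>w. \<Delta> k w powr q)) \<le> (expectation (potential 0) - fstar) / rate"
    using rate_pos by (simp add: lessThan_Suc_atMost field_simps)
qed

section \<open>Almost sure behaviour of steps and errors\<close>

lemma AE_\<Delta>_tendsto_zero: "AE w in M. (\<lambda>k. \<Delta> k w) \<longlonglongrightarrow> 0"
proof (rule AE_tendsto_zero_if_summable_prob)
  fix a :: real assume a: "0 < a"
  let ?g = "\<lambda>k. expectation (\<lambda>w. \<Delta> k w powr q) / a powr q"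
  have markov: "prob {w \<in> space M. a \<le> \<bar>\<Delta> k w\<bar>} \<le> ?g k" for k
  proof -
    have "prob {w \<in> space M. a \<le> \<bar>\<Delta> k w\<bar>} \<le> prob {w \<in> space M. a powr q \<le> \<Delta> k w powr q}"
      using a \<Delta>_pos q_gt_1
      by (intro finite_measure_mono) (auto intro!: powr_mono2 simp: abs_of_pos)
    also have "\<dots> \<le> expectation (\<lambda>w. \<Delta> k w powr q) / a powr q"
      using a by (intro integral_Markov_inequality_measure[OF \<Delta>_powr_integrable]) auto
    finally show ?thesis .
  qed
  show "summable (\<lambda>k. prob {w \<in> space M. a \<le> \<bar>\<Delta> k w\<bar>})"
  proof (rule summable_comparison_test'[where N = 0 and g = ?g])
    show "summable ?g"
      by (rule summable_divide[OF summable_expected_\<Delta>_powr])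
  qed (use markov in simp)
qed measurable

text \<open>In the unit \<open>\<Delta>\<^sup>q\<close> the level \<open>a \<Delta>\<close> is the random threshold \<open>a \<Delta>\<^bsup>1-q\<^esup>\<close>, and the conjugate
  exponent turns it into \<open>\<Delta>\<^sup>q\<close> again, whose expectations are summable.\<close>

lemma prob_large_error_le:
  assumes a: "0 < a"
  shows "prob {w \<in> space M. a * \<Delta> k w \<le> \<bar>err k w\<bar>}
    \<le> \<epsilon> / a powr conj_exponent q * expectation (\<lambda>w. \<Delta> k w powr q)"
proof -
  let ?N = "past M G F Fg k"
  interpret N: finite_measure_subalgebra M ?N
    by unfold_locales (rule subalgebra_past)
  define r where "r = conj_exponent q"
  define U where "U = (\<lambda>w. a * \<Delta> k w powr (1 - q))"
  let ?E = "{v \<in> space M. U v \<le> scaled_err k v}"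
  have [measurable]: "\<Delta> k \<in> borel_measurable ?N"
    by (simp add: iterate_past_measurable)
  have "a * \<Delta> k w \<le> \<bar>err k w\<bar> \<longleftrightarrow> U w \<le> scaled_err k w" if "w \<in> space M" for w
    using \<Delta>_pos[OF that, of k] by (simp add: U_def scaled_err_def powr_diff field_simps)
  then have "{w \<in> space M. a * \<Delta> k w \<le> \<bar>err k w\<bar>} = ?E"
    by blast
  moreover have "?E \<in> sets M"
    unfolding U_def by measurable
  ultimately have "prob {w \<in> space M. a * \<Delta> k w \<le> \<bar>err k w\<bar>} = (\<integral>w. 1 * indicator ?E w \<partial>M)"
    by simp
  also have "\<dots> \<le> (\<integral>w. \<epsilon> / a powr r * \<Delta> k w powr q \<partial>M)"
  proof (rule N.integral_weighted_tail_le[where h = "\<lambda>\<alpha>. \<epsilon> / \<alpha> powr r"])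
    show "continuous_on {0<..} (\<lambda>\<alpha>. \<epsilon> / \<alpha> powr r)"
      by (intro continuous_intros) auto
    show "0 < U w" if "w \<in> space M" for w
      using a \<Delta>_pos[OF that, of k] by (simp add: U_def)
    show "1 * (\<epsilon> / U w powr r) \<le> \<epsilon> / a powr r * \<Delta> k w powr q" if "w \<in> space M" for w
    proof -
      have "(1 - q) * r = - q"
        using q_gt_1 by (simp add: r_def conj_exponent_def field_simps)
      then have "U w powr r = a powr r * \<Delta> k w powr (- q)"
        using a \<Delta>_pos[OF that, of k] by (simp add: U_def powr_mult powr_powr)
      then show ?thesis
        by (simp add: powr_minus field_simps)
    qed
    show "AE w in M. real_cond_exp M ?N (indicator {v \<in> space M. \<alpha> \<le> scaled_err k v}) w
        \<le> \<epsilon> / \<alpha> powr r" if "0 < \<alpha>" for \<alpha>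
      unfolding r_def using that by (rule scaled_err_tail)
  qed (use \<Delta>_powr_integrable in \<open>auto simp: U_def\<close>)
  finally show ?thesis
    by (simp add: r_def)
qed

lemma AE_err_over_\<Delta>_tendsto_zero: "AE w in M. (\<lambda>k. err k w / \<Delta> k w) \<longlonglongrightarrow> 0"
proof (rule AE_tendsto_zero_if_summable_prob)
  fix a :: real assume a: "0 < a"
  let ?g = "\<lambda>k. \<epsilon> / a powr conj_exponent q * expectation (\<lambda>w. \<Delta> k w powr q)"
  have "{w \<in> space M. a \<le> \<bar>err k w / \<Delta> k w\<bar>} = {w \<in> space M. a * \<Delta> k w \<le> \<bar>err k w\<bar>}" for k
    using \<Delta>_pos[of _ k] by (auto simp: abs_divide abs_of_pos pos_le_divide_eq)
  then have tail: "prob {w \<in> space M. a \<le> \<bar>err k w / \<Delta> k w\<bar>} \<le> ?g k" for k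
    using prob_large_error_le[OF a, of k] by simp
  show "summable (\<lambda>k. prob {w \<in> space M. a \<le> \<bar>err k w / \<Delta> k w\<bar>})"
  proof (rule summable_comparison_test'[where N = 0 and g = ?g])
    show "summable ?g"
      by (rule summable_mult[OF summable_expected_\<Delta>_powr])
  qed (use tail in simp)
qed measurable

text \<open>Along indices where \<open>G\<close> tends to \<open>d / norm d\<close>, the step \<open>\<Delta> G\<close> is rewritten as
  \<open>(\<Delta> / norm d) (norm d G)\<close>, so that directions of any nonzero length are handled at once. The
  rejected test bounds the difference quotient from below up to the null sequence
  \<open>norm d (\<theta> \<Delta>\<^bsup>q-1\<^esup> + \<bar>err / \<Delta>\<bar>)\<close>.\<close>

lemma unsuccessful_limit_clarke_stationary:
  assumes w: "w \<in> space M"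
    and f_lip: "locally_lipschitz f"
    and \<Delta>_lim: "(\<lambda>k. \<Delta> k w) \<longlonglongrightarrow> 0"
    and err_lim: "(\<lambda>k. err k w / \<Delta> k w) \<longlonglongrightarrow> 0"
    and L: "L \<subseteq> unsuccessful \<theta> q F Fg \<Delta> w"
    and dense: "dense_in_sphere L (\<lambda>k. G k w)"
    and X_lim: "tendsto_along L (\<lambda>k. X k w) xs"
  shows "clarke_stationary f xs"
  unfolding clarke_stationary_def
proof
  fix d
  show "0 \<le> clarke_deriv f xs d"
  proof (cases "d = 0")
    case True
    then show ?thesis
      by (simp add: clarke_deriv_zero_direction)
  next
    case False
    have "norm (d /\<^sub>R norm d) = 1"
      using False by simp
    then obtain S where S: "S \<subseteq> L" "infinite S" "tendsto_along S (\<lambda>k. G k w) (d /\<^sub>R norm d)"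
      using dense unfolding dense_in_sphere_def by blast
    let ?A = "inf sequentially (principal S)"
    obtain U C where U: "open U" "xs \<in> U" "C-lipschitz_on U f"
      using f_lip unfolding locally_lipschitz_def by blast
    have \<Delta>: "0 < \<Delta> k w" for k
      by (rule \<Delta>_pos[OF w])
    show ?thesis
    proof (rule clarke_deriv_nonneg_along_filter[OF _ U,
          where A = ?A and x = "\<lambda>k. X k w" and t = "\<lambda>k. \<Delta> k w / norm d"
            and g = "\<lambda>k. norm d *\<^sub>R G k w"
            and e = "\<lambda>k. norm d * (\<theta> * \<Delta> k w powr (q - 1) + \<bar>err k w / \<Delta> k w\<bar>)"])
      show "?A \<noteq> bot"
        by (rule sequentially_along_infinite_nontrivial[OF S(2)])
      show "((\<lambda>k. X k w) \<longlongrightarrow> xs) ?A"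
        using X_lim S(1) unfolding tendsto_along_def
        by (elim tendsto_mono[rotated]) (intro inf_mono order_refl, simp)
      have "((\<lambda>k. \<Delta> k w / norm d) \<longlonglongrightarrow> 0 / norm d)"
        by (intro tendsto_divide \<Delta>_lim tendsto_const) (use False in simp)
      then show "((\<lambda>k. \<Delta> k w / norm d) \<longlongrightarrow> 0) ?A"
        by (auto intro: tendsto_mono[rotated])
      show "\<forall>\<^sub>F k in ?A. 0 < \<Delta> k w / norm d"
        using \<Delta> False by simp
      have "((\<lambda>k. norm d *\<^sub>R G k w) \<longlongrightarrow> norm d *\<^sub>R (d /\<^sub>R norm d)) ?A"
        using S(3) unfolding tendsto_along_def by (intro tendsto_intros)
      then show "((\<lambda>k. norm d *\<^sub>R G k w) \<longlongrightarrow> d) ?A"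
        using False by simp
      have powr_lim: "(\<lambda>k. \<Delta> k w powr (q - 1)) \<longlonglongrightarrow> 0 powr (q - 1)"
        using \<Delta> q_gt_1 by (intro tendsto_powr' \<Delta>_lim tendsto_const) (auto simp: less_imp_le)
      have "(\<lambda>k. norm d * (\<theta> * \<Delta> k w powr (q - 1) + \<bar>err k w / \<Delta> k w\<bar>))
          \<longlonglongrightarrow> norm d * (\<theta> * 0 powr (q - 1) + \<bar>0\<bar>)"
        by (intro tendsto_mult tendsto_add tendsto_rabs tendsto_const powr_lim err_lim)
      then show "((\<lambda>k. norm d * (\<theta> * \<Delta> k w powr (q - 1) + \<bar>err k w / \<Delta> k w\<bar>)) \<longlongrightarrow> 0) ?A"
        by (auto intro: tendsto_mono[rotated])
      have "- (norm d * (\<theta> * \<Delta> k w powr (q - 1) + \<bar>err k w / \<Delta> k w\<bar>))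
          \<le> (f (X k w + (\<Delta> k w / norm d) *\<^sub>R (norm d *\<^sub>R G k w)) - f (X k w)) / (\<Delta> k w / norm d)"
        if "k \<in> S" for k
      proof -
        have "F k w - Fg k w < \<theta> * \<Delta> k w powr q"
          using that S(1) L by (auto simp: unsuccessful_def)
        then have "decrease k w \<le> \<theta> * \<Delta> k w powr q + \<bar>err k w\<bar>"
          by (simp add: err_def)
        then have "decrease k w / \<Delta> k w \<le> \<theta> * \<Delta> k w powr (q - 1) + \<bar>err k w / \<Delta> k w\<bar>"
          using \<Delta>[of k] by (simp add: powr_diff field_simps)
        then have "norm d * (decrease k w / \<Delta> k w)
            \<le> norm d * (\<theta> * \<Delta> k w powr (q - 1) + \<bar>err k w / \<Delta> k w\<bar>)"
          by (intro mult_left_mono) auto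
        moreover have "(f (X k w + (\<Delta> k w / norm d) *\<^sub>R (norm d *\<^sub>R G k w)) - f (X k w))
            / (\<Delta> k w / norm d) = - (norm d * (decrease k w / \<Delta> k w))"
          using False by (simp add: decrease_def algebra_simps diff_divide_distrib)
        ultimately show ?thesis
          by linarith
      qed
      then show "\<forall>\<^sub>F k in ?A. - (norm d * (\<theta> * \<Delta> k w powr (q - 1) + \<bar>err k w / \<Delta> k w\<bar>))
          \<le> (f (X k w + (\<Delta> k w / norm d) *\<^sub>R (norm d *\<^sub>R G k w)) - f (X k w)) / (\<Delta> k w / norm d)"
        by (simp add: eventually_inf_principal)
    qed
  qed
qed

end

section \<open>Almost sure Clarke stationarity\<close>

theorem theorem3p3:
  fixes f :: "real ^ 'n \<Rightarrow> real"
    and M :: "'w measure"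
    and x0 :: "real ^ 'n"
    and \<delta>0 \<theta> q \<tau> \<tau>bar fstar Lf \<epsilon> :: real
    and G X :: "nat \<Rightarrow> 'w \<Rightarrow> real ^ 'n"
    and F Fg \<Delta> :: "nat \<Rightarrow> 'w \<Rightarrow> real"
  assumes sds: "stochastic_direct_search M x0 \<delta>0 \<theta> q \<tau> \<tau>bar G F Fg X \<Delta>"
    and f_loc_lip: "locally_lipschitz f"
    and f_inf: "(INF x. ereal (f x)) = ereal fstar"
    and f_lip: "AE w in M. \<forall>x. seq_limit_point (\<lambda>k. X k w) x \<longrightarrow>
                  (\<exists>U. open U \<and> x \<in> U \<and> Lf-lipschitz_on U f)"
    and \<epsilon>_pos: "\<epsilon> > 0"
    and tail_bound: "\<forall>k. \<forall>\<alpha>>0. AE w in M.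
          cond_prob_given M (past M G F Fg k)
            {v \<in> space M. \<bar>F k v - Fg k v - (f (X k v) - f (X k v + \<Delta> k v *\<^sub>R G k v))\<bar>
                            \<ge> \<alpha> * \<Delta> k v powr q} w
          \<le> \<epsilon> / \<alpha> powr conj_exponent q"
    and \<theta>_large: "\<theta> > \<epsilon> powr (1 / conj_exponent q) * tau_bar q \<tau> / tau_minus q \<tau>"
  shows "AE w in M. \<forall>L Xstar.
           L \<subseteq> unsuccessful \<theta> q F Fg \<Delta> w \<and>
           dense_in_sphere L (\<lambda>k. G k w) \<and>
           tendsto_along L (\<lambda>k. X k w) Xstar \<longrightarrow>
           clarke_stationary f Xstar"
proof -
  interpret stochastic_direct_search M x0 \<delta>0 \<theta> q \<tau> \<tau>bar G F Fg X \<Delta>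
    by (rule sds)
  interpret direct_search_with_objective M x0 \<delta>0 \<theta> q \<tau> \<tau>bar G F Fg X \<Delta> f fstar \<epsilon>
  proof unfold_locales
    show "continuous_on UNIV f"
      by (rule continuous_on_if_locally_lipschitz[OF f_loc_lip])
    show "fstar \<le> f x" for x
      using INF_lower[of x UNIV "\<lambda>x. ereal (f x)"] by (simp add: f_inf)
  qed (use \<epsilon>_pos tail_bound \<theta>_large in auto)
  show ?thesis
    using AE_\<Delta>_tendsto_zero AE_err_over_\<Delta>_tendsto_zero AE_space
    by eventually_elim (use unsuccessful_limit_clarke_stationary f_loc_lip in blast)
qed

end
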